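(* Let $p$ be a prime and $\mathcal{S}_p = \{1,\ldots,p-2\}$. Define permutations $F, G : \mathcal{S}_p \to \mathcal{S}_p$ by $F(s) \equiv -1-s \pmod p$ and $G(s) \equiv 1/s \pmod p$ (with values taken in $\mathcal{S}_p$). Then for every $s \in \mathcal{S}_p$ we have $\vartheta_{p,F(s)} = \vartheta_{p,s}$ and $\vartheta_{p,G(s)} = \vartheta_{p,s}$.
   Context: For a prime $p$ and an integer $u$ with $\gcd(u,p)=1$, the Fermat quotient $q_p(u)$ is the unique integer with $0 \le q_p(u) < p$ and $q_p(u) \equiv (u^{p-1}-1)/p \pmod p$. For a rational number $a/b$ with $a,b$ integers coprime to $p$, $q_p(a/b)$ denotes the residue of $q_p(a) - q_p(b)$ modulo $p$ (equivalently, of $((a/b)^{p-1}-1)/p$ computed in the $p$-adic integers); in particular $q_p\big(s^s/(s+1)^{s+1}\big) \equiv s\,q_p(s) - (s+1)\,q_p(s+1) \pmod p$. For $s \in \{1,\ldots,p-2\}$ define the Legendre symbol $$\vartheta_{p,s} = \left(\frac{2s(s+1)\, q_p\big(s^s/(s+1)^{s+1}\big)}{p}\right) \in \{0, 1, -1\}.$$ *)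

theory Defs
  imports "HOL-Number_Theory.Number_Theory"
begin

text \<open>The division by \<open>p\<close> is exact for \<open>coprime u p\<close> by Fermat's theorem, see
  \<open>fermat_quotient_exact\<close>.\<close>

definition fermat_quotient :: "int \<Rightarrow> int \<Rightarrow> int" where
  "fermat_quotient p u = ((u ^ nat (p - 1) - 1) div p) mod p"

text \<open>The definition uses the reduced fraction. By \<open>fermat_quotient_rat_divide\<close> any
  other representation with numerator and denominator coprime to \<open>p\<close> gives the same
  value.\<close>

definition fermat_quotient_rat :: "int \<Rightarrow> rat \<Rightarrow> int" where
  "fermat_quotient_rat p r =
     (case quotient_of r of (a, b) \<Rightarrow> (fermat_quotient p a - fermat_quotient p b) mod p)"

definition S_set :: "int \<Rightarrow> int set" where
  "S_set p = {1..p - 2}"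

definition theta :: "int \<Rightarrow> int \<Rightarrow> int" where
  "theta p s =
     Legendre
       (2 * s * (s + 1) *
         fermat_quotient_rat p (of_int s ^ nat s / of_int (s + 1) ^ nat (s + 1))) p"

text \<open>The values below are the representatives in \<open>{0..<p}\<close>. For \<open>s \<in> S_set p\<close> they
  lie in \<open>S_set p\<close>.\<close>

definition F_perm :: "int \<Rightarrow> int \<Rightarrow> int" where
  "F_perm p s = (- 1 - s) mod p"

definition G_perm :: "int \<Rightarrow> int \<Rightarrow> int" where
  "G_perm p s = modular_inverse p s"

lemma fermat_quotient_exact:
  fixes p u :: int
  assumes "prime p" "coprime u p"
  shows "p dvd u ^ nat (p - 1) - 1"
proof -
  have p: "p > 1" using assms(1) prime_gt_1_int by blast
  have "[u ^ totient (nat p) = 1] (mod p)"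
    using residues.euler_theorem[of p u] p assms(2) by (simp add: residues_def)
  moreover have "totient (nat p) = nat (p - 1)"
  proof -
    have "prime (nat p)" using assms(1) prime_int_nat_transfer by blast
    then have "totient (nat p) = nat p - 1" by (rule totient_prime)
    also have "nat p - 1 = nat (p - 1)" using p by linarith
    finally show ?thesis .
  qed
  ultimately show ?thesis by (simp add: cong_iff_dvd_diff)
qed

lemma fermat_quotient_cong:
  fixes p u :: int
  assumes "prime p" "coprime u p"
  obtains k where "u ^ nat (p - 1) = 1 + p * k" "[fermat_quotient p u = k] (mod p)"
proof -
  obtain k where k: "u ^ nat (p - 1) - 1 = p * k"
    using fermat_quotient_exact[OF assms] unfolding dvd_def by blast
  have "p \<noteq> 0" using assms(1) by auto
  then have "[fermat_quotient p u = k] (mod p)"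
    by (simp add: fermat_quotient_def k cong_def)
  moreover have "u ^ nat (p - 1) = 1 + p * k" using k by linarith
  ultimately show thesis by (rule that[rotated])
qed

lemma fermat_quotient_mult:
  fixes p u v :: int
  assumes p: "prime p" and u: "coprime u p" and v: "coprime v p"
  shows "[fermat_quotient p (u * v) = fermat_quotient p u + fermat_quotient p v] (mod p)"
proof -
  obtain k where k: "u ^ nat (p - 1) = 1 + p * k" "[fermat_quotient p u = k] (mod p)"
    using fermat_quotient_cong[OF p u] .
  obtain l where l: "v ^ nat (p - 1) = 1 + p * l" "[fermat_quotient p v = l] (mod p)"
    using fermat_quotient_cong[OF p v] .
  have "coprime (u * v) p" using u v by simp
  then obtain m where m: "(u * v) ^ nat (p - 1) = 1 + p * m"
    "[fermat_quotient p (u * v) = m] (mod p)"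
    using fermat_quotient_cong[OF p] by blast
  have "p * m = p * (k + l + p * (k * l))"
    using m(1) by (simp add: power_mult_distrib k(1) l(1) algebra_simps)
  moreover have "p \<noteq> 0" using p by auto
  ultimately have "m = k + l + p * (k * l)" by simp
  then have "[m = k + l] (mod p)" by (simp add: cong_iff_dvd_diff)
  with m(2) have "[fermat_quotient p (u * v) = k + l] (mod p)" by (rule cong_trans)
  also have "[k + l = fermat_quotient p u + fermat_quotient p v] (mod p)"
    using k(2) l(2) by (intro cong_add) (auto simp: cong_sym)
  finally show ?thesis .
qed

lemma fermat_quotient_power:
  fixes p u :: int
  assumes p: "prime p" and u: "coprime u p"
  shows "[fermat_quotient p (u ^ n) = int n * fermat_quotient p u] (mod p)"
proof (induction n)
  case 0
  show ?case by (simp add: fermat_quotient_def)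
next
  case (Suc n)
  have "[fermat_quotient p (u ^ Suc n) = fermat_quotient p u + fermat_quotient p (u ^ n)] (mod p)"
    using fermat_quotient_mult[OF p u, of "u ^ n"] u by simp
  also have "[fermat_quotient p u + fermat_quotient p (u ^ n) =
      fermat_quotient p u + int n * fermat_quotient p u] (mod p)"
    using Suc by (intro cong_add cong_refl)
  finally show ?case by (simp add: algebra_simps)
qed

lemma fermat_quotient_rat_divide:
  fixes p a b :: int
  assumes p: "prime p" and a: "coprime a p" and b: "coprime b p"
  shows "fermat_quotient_rat p (of_int a / of_int b) =
           (fermat_quotient p a - fermat_quotient p b) mod p"
proof -
  obtain c d where cd: "quotient_of (of_int a / of_int b) = (c, d)" by fastforce
  have d0: "d > 0" and cop: "coprime c d"
    using quotient_of_denom_pos[OF cd] quotient_of_coprime[OF cd] .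
  have b0: "b \<noteq> 0" using b p by auto
  have "of_int a / of_int b = (of_int c / of_int d :: rat)"
    using quotient_of_div[OF cd] .
  then have "(of_int (a * d) :: rat) = of_int (c * b)"
    using d0 b0 by (simp add: field_simps)
  then have eq: "a * d = c * b" by (simp only: of_int_eq_iff)
  have nd: "coprime x p \<longleftrightarrow> \<not> p dvd x" for x
  proof
    assume "coprime x p"
    then show "\<not> p dvd x" using coprime_common_divisor[of x p p] p not_prime_unit[of p] by auto
  next
    assume "\<not> p dvd x"
    then show "coprime x p" using prime_imp_coprime[OF p, of x] by (simp add: coprime_commute)
  qed
  have "\<not> p dvd c \<and> \<not> p dvd d"
  proof -
    have "p dvd d \<longleftrightarrow> p dvd c"
      using a b nd prime_dvd_mult_iff[OF p, of a d] prime_dvd_mult_iff[OF p, of c b] eq by auto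
    moreover have "\<not> (p dvd c \<and> p dvd d)"
      using coprime_common_divisor[OF cop, of p] p by auto
    ultimately show ?thesis by blast
  qed
  then have c: "coprime c p" and d: "coprime d p" using nd by auto
  have "[fermat_quotient p a + fermat_quotient p d = fermat_quotient p (a * d)] (mod p)"
    using fermat_quotient_mult[OF p a d] by (rule cong_sym)
  also have "[fermat_quotient p (a * d) = fermat_quotient p c + fermat_quotient p b] (mod p)"
    using fermat_quotient_mult[OF p c b] eq by simp
  finally have "p dvd (fermat_quotient p a + fermat_quotient p d)
      - (fermat_quotient p c + fermat_quotient p b)"
    by (simp add: cong_iff_dvd_diff)
  then have "[fermat_quotient p c - fermat_quotient p d
      = fermat_quotient p a - fermat_quotient p b] (mod p)"
    by (subst cong_sym_eq) (simp add: cong_iff_dvd_diff algebra_simps)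
  then show ?thesis by (simp add: fermat_quotient_rat_def cd cong_def)
qed

lemma fermat_quotient_rat_theta:
  fixes p s :: int
  assumes p: "prime p" and s: "s \<in> S_set p"
  shows "[fermat_quotient_rat p (of_int s ^ nat s / of_int (s + 1) ^ nat (s + 1)) =
           s * fermat_quotient p s - (s + 1) * fermat_quotient p (s + 1)] (mod p)"
proof -
  have cop: "coprime x p" if "0 < x" "x < p" for x
    using prime_imp_coprime[OF p, of x] zdvd_not_zless[OF that] by (simp add: coprime_commute)
  have s1: "coprime s p" and s2: "coprime (s + 1) p"
    using s by (auto simp: S_set_def intro!: cop)
  have "fermat_quotient_rat p (of_int (s ^ nat s) / of_int ((s + 1) ^ nat (s + 1))) =
      (fermat_quotient p (s ^ nat s) - fermat_quotient p ((s + 1) ^ nat (s + 1))) mod p"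
    using s1 s2 by (intro fermat_quotient_rat_divide p) simp_all
  then have "[fermat_quotient_rat p (of_int s ^ nat s / of_int (s + 1) ^ nat (s + 1)) =
      fermat_quotient p (s ^ nat s) - fermat_quotient p ((s + 1) ^ nat (s + 1))] (mod p)"
    by (simp add: cong_def)
  also have "[fermat_quotient p (s ^ nat s) - fermat_quotient p ((s + 1) ^ nat (s + 1)) =
      int (nat s) * fermat_quotient p s
      - int (nat (s + 1)) * fermat_quotient p (s + 1)] (mod p)"
    by (intro cong_diff fermat_quotient_power p s1 s2)
  finally show ?thesis using s by (simp add: S_set_def)
qed

end

theory Submission
  imports Defs
begin

text \<open>Modulo \<open>p\<close>, the Fermat quotient satisfies \<open>u q(u + p k) = u q(u) - k\<close>, \<open>q(-u) = q(u)\<close> and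
  \<open>q(u v) = q(u) + q(v)\<close>. Put \<open>A(s) = s q(s) - (s + 1) q(s + 1)\<close>. If \<open>t = p - 1 - s\<close>, the two
  correction terms from the shift by \<open>p\<close> cancel and \<open>A(t) = A(s)\<close>. If \<open>t s = 1 + p k\<close>, expanding
  \<open>q(t s)\<close> and \<open>q((t + 1) s) = q(s + 1 + p k)\<close> gives \<open>s A(t) = A(s)\<close>. So the argument of the
  Legendre symbol is unchanged in the first case, and in the second
  \<open>s\<^sup>4 \<cdot> 2 t (t + 1) A(t) = 2 s (s + 1) A(s)\<close>.\<close>

text \<open>A square root of \<open>y\<close> times \<open>c\<close> is a square root of
  \<open>x\<close>; the converse follows by scaling with an inverse of \<open>c\<close>. The case
  \<open>c = 1\<close> says that the symbol depends only on the residue class.\<close>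

lemma Legendre_cong_square_mult:
  fixes p x y c :: int
  assumes c: "coprime c p" and xy: "[x = c\<^sup>2 * y] (mod p)"
  shows "Legendre x p = Legendre y p"
proof -
  have QR: "QuadRes p a" if b: "QuadRes p b" and ab: "[a = c\<^sup>2 * b] (mod p)" for a b c
  proof -
    obtain z where "[z\<^sup>2 = b] (mod p)"
      using b unfolding QuadRes_def by blast
    then have "[(c * z)\<^sup>2 = c\<^sup>2 * b] (mod p)"
      unfolding power_mult_distrib by (intro cong_mult cong_refl)
    with ab show ?thesis
      unfolding QuadRes_def by (meson cong_sym cong_trans)
  qed
  \<comment> \<open>Multiplying by \<open>d\<^sup>2\<close> undoes the scaling, so \<open>QR\<close>
    also applies with \<open>x\<close> and \<open>y\<close> exchanged.\<close>
  define d where "d = modular_inverse p c"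
  have "[(d * c)\<^sup>2 * y = 1\<^sup>2 * y] (mod p)"
    unfolding d_def by (intro cong_mult cong_pow cong_modular_inverse2 c cong_refl)
  moreover have "[d\<^sup>2 * x = d\<^sup>2 * (c\<^sup>2 * y)] (mod p)"
    by (intro cong_mult cong_refl xy)
  ultimately have yx: "[y = d\<^sup>2 * x] (mod p)"
    by (simp add: power_mult_distrib mult.assoc) (meson cong_sym cong_trans)
  have "p dvd x \<longleftrightarrow> p dvd y"
    using xy yx by (meson cong_dvd_iff dvd_mult)
  moreover have "QuadRes p x \<longleftrightarrow> QuadRes p y"
    using QR xy yx by blast
  ultimately show ?thesis
    by (simp add: Legendre_def cong_0_iff)
qed

text \<open>First-order binomial expansion in \<open>h\<close>. The extra factor \<open>u\<close>
  turns the usual \<open>u ^ (n - 1)\<close> into \<open>u ^ n\<close>, which avoids a truncated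
  exponent.\<close>

lemma cong_add_power_mod_square:
  fixes u h :: int
  shows "[u * (u + h) ^ n = u * u ^ n + int n * u ^ n * h] (mod h\<^sup>2)"
proof (induction n)
  case (Suc n)
  have "[(u + h) * (u * (u + h) ^ n) = (u + h) * (u * u ^ n + int n * u ^ n * h)] (mod h\<^sup>2)"
    using Suc by (intro cong_mult cong_refl)
  also have "(u + h) * (u * u ^ n + int n * u ^ n * h) =
      u * u ^ Suc n + int (Suc n) * u ^ Suc n * h + h\<^sup>2 * (int n * u ^ n)"
    by (simp add: algebra_simps power2_eq_square)
  also have "[\<dots> = u * u ^ Suc n + int (Suc n) * u ^ Suc n * h] (mod h\<^sup>2)"
    by (simp add: cong_iff_dvd_diff)
  finally show ?case by (simp add: algebra_simps)
qed simp

text \<open>Expand with \<open>h = p * k\<close> and exponent \<open>p - 1\<close>. As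
  \<open>u ^ (p - 1)\<close> is 1 and the factor \<open>p - 1\<close> is -1 modulo \<open>p\<close>,
  the linear term is \<open>- p * k\<close> modulo \<open>p * p\<close>; dividing by
  \<open>p\<close> leaves \<open>- k\<close>.\<close>

lemma fermat_quotient_add_mult:
  fixes p u k :: int
  assumes p: "prime p" and u: "coprime u p"
  shows "[u * fermat_quotient p (u + p * k) = u * fermat_quotient p u - k] (mod p)"
proof -
  have p1: "p > 1" using p prime_gt_1_int by blast
  obtain l where l: "u ^ nat (p - 1) = 1 + p * l" "[fermat_quotient p u = l] (mod p)"
    using fermat_quotient_cong[OF p u] .
  have "coprime (u + p * k) p"
    using u by (metis coprime_iff_gcd_eq_1 gcd.commute gcd_add_mult add.commute mult.commute)
  then obtain m where m: "(u + p * k) ^ nat (p - 1) = 1 + p * m"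
      "[fermat_quotient p (u + p * k) = m] (mod p)"
    using fermat_quotient_cong[OF p] by blast
  have "(p * k)\<^sup>2 dvd u * (1 + p * m) - (u * (1 + p * l) + (p - 1) * (1 + p * l) * (p * k))"
    using cong_add_power_mod_square[of u "p * k" "nat (p - 1)"] p1
    by (simp add: m(1) l(1) cong_iff_dvd_diff)
  then have "p * p dvd u * (1 + p * m) - (u * (1 + p * l) + (p - 1) * (1 + p * l) * (p * k))"
    by (rule dvd_trans[rotated]) (simp add: power2_eq_square)
  also have "u * (1 + p * m) - (u * (1 + p * l) + (p - 1) * (1 + p * l) * (p * k)) =
      p * ((u * m - (u * l - k)) - p * ((1 + p * l - l) * k))"
    by (simp add: algebra_simps)
  finally have "p dvd (u * m - (u * l - k)) - p * ((1 + p * l - l) * k)"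
    using p1 by (subst (asm) dvd_mult_cancel_left) auto
  then have "[u * m = u * l - k] (mod p)"
    by (simp add: cong_iff_dvd_diff dvd_diff_left_iff)
  moreover have "[u * fermat_quotient p (u + p * k) = u * m] (mod p)"
    by (intro cong_mult cong_refl m)
  moreover have "[u * fermat_quotient p u - k = u * l - k] (mod p)"
    by (intro cong_mult cong_diff cong_refl l)
  ultimately show ?thesis by (meson cong_sym cong_trans)
qed

lemma fermat_quotient_minus:
  assumes "odd p" "p > 0"
  shows "fermat_quotient p (- u) = fermat_quotient p u"
proof -
  have "even (nat (p - 1))" using assms by (simp add: even_nat_iff)
  then show ?thesis by (simp add: fermat_quotient_def)
qed

lemma coprime_prime_int:
  fixes p x :: int
  assumes "prime p" "0 < x" "x < p"
  shows "coprime x p"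
  using prime_imp_coprime[OF assms(1), of x] zdvd_not_zless[OF assms(2,3)]
  by (simp add: coprime_commute)

text \<open>The quantity A(s): a fraction-free integer congruent to the rational Fermat quotient in
  \<open>theta\<close> for \<open>s\<close> in \<open>S_set p\<close>.\<close>

definition theta_factor :: "int \<Rightarrow> int \<Rightarrow> int" where
  "theta_factor p s = s * fermat_quotient p s - (s + 1) * fermat_quotient p (s + 1)"

lemma theta_eq_Legendre:
  assumes "prime p" "s \<in> S_set p"
  shows "theta p s = Legendre (2 * s * (s + 1) * theta_factor p s) p"
  unfolding theta_def
proof (rule Legendre_cong_square_mult)
  show "coprime 1 p" by simp
  show "[2 * s * (s + 1) *
        fermat_quotient_rat p (of_int s ^ nat s / of_int (s + 1) ^ nat (s + 1)) =
      1\<^sup>2 * (2 * s * (s + 1) * theta_factor p s)] (mod p)"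
    using cong_mult[OF cong_refl fermat_quotient_rat_theta[OF assms]]
    by (simp add: theta_factor_def)
qed

lemma F_perm_eq:
  assumes "s \<in> S_set p"
  shows "F_perm p s = p - 1 - s"
proof -
  have "F_perm p s = (- 1 - s + p) mod p"
    unfolding F_perm_def by (rule mod_add_self2[symmetric])
  also have "- 1 - s + p = p - 1 - s" by simp
  finally show ?thesis using assms by (simp add: S_set_def)
qed

lemma bij_betw_F_perm: "bij_betw (F_perm p) (S_set p) (S_set p)"
  \<comment> \<open>The reflection is an involution, hence its own inverse.\<close>
  by (rule bij_betw_byWitness[where f' = "F_perm p"]) (auto simp: F_perm_eq S_set_def)

lemma theta_factor_F_perm:
  assumes p: "prime p" and s: "s \<in> S_set p"
  shows "[theta_factor p (F_perm p s) = theta_factor p s] (mod p)"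
proof -
  \<comment> \<open>\<open>S_set 2\<close> is empty, so the existence of \<open>s\<close> forces
    \<open>p\<close> to be odd.\<close>
  have p3: "p > 2" using s by (simp add: S_set_def)
  then have odd: "odd p" using p prime_odd_int by blast
  \<comment> \<open>This is the shift of \<open>- u\<close> by one \<open>p\<close>, followed by
    evenness of the Fermat quotient. It is used at \<open>s + 1\<close> and at \<open>s\<close>, and
    the two terms -1 cancel in the difference.\<close>
  have reflect: "[(p - u) * fermat_quotient p (p - u) = - u * fermat_quotient p u - 1] (mod p)"
    if "coprime u p" for u
  proof -
    have "[- u * fermat_quotient p (- u + p * 1) = - u * fermat_quotient p (- u) - 1] (mod p)"
      using that by (intro fermat_quotient_add_mult p) simp
    moreover have "[(p - u) * fermat_quotient p (p - u) = - u * fermat_quotient p (p - u)] (mod p)"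
      by (simp add: cong_iff_dvd_diff algebra_simps)
    ultimately show ?thesis
      using p3 odd by (auto simp: fermat_quotient_minus elim: cong_trans)
  qed
  have "[(p - (s + 1)) * fermat_quotient p (p - (s + 1)) - (p - s) * fermat_quotient p (p - s) =
      (- (s + 1) * fermat_quotient p (s + 1) - 1) - (- s * fermat_quotient p s - 1)] (mod p)"
    using s by (intro cong_diff reflect coprime_prime_int p) (auto simp: S_set_def)
  then show ?thesis
    by (simp add: theta_factor_def F_perm_eq[OF s] algebra_simps)
qed

lemma G_perm_in_S_set:
  assumes p: "prime p" and s: "s \<in> S_set p"
  shows "G_perm p s \<in> S_set p"
proof -
  have cop: "coprime s p" using s by (intro coprime_prime_int p) (auto simp: S_set_def)
  have p1: "p > 1" using p prime_gt_1_int by blast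
  \<comment> \<open>The residue -1 is its own inverse, so this value would force \<open>p\<close> to
    divide \<open>s + 1\<close>, which lies strictly between 0 and \<open>p\<close>.\<close>
  have "modular_inverse p s \<noteq> p - 1"
  proof
    assume "modular_inverse p s = p - 1"
    then have "[s * (p - 1) = 1] (mod p)" using cong_modular_inverse1[OF cop] by simp
    then have "p dvd s * p - (s + 1)" by (simp add: cong_iff_dvd_diff algebra_simps)
    then have "p dvd s + 1" by (simp add: dvd_diff_right_iff)
    then show False using zdvd_not_zless[of "s + 1" p] s by (auto simp: S_set_def)
  qed
  then show ?thesis
    using mult_modular_inverse_int_pos[OF p1 cop] modular_inverse_int_less[of p s] p1
    by (auto simp: G_perm_def S_set_def)
qed

lemma bij_betw_G_perm:
  assumes p: "prime p"
  shows "bij_betw (G_perm p) (S_set p) (S_set p)"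
proof (rule bij_betw_byWitness[where f' = "G_perm p"])
  have "G_perm p (G_perm p s) = s" if s: "s \<in> S_set p" for s
    unfolding G_perm_def
    using s by (intro modular_inverse_int_eqI cong_modular_inverse2 coprime_prime_int p)
      (auto simp: S_set_def)
  then show "\<forall>s\<in>S_set p. G_perm p (G_perm p s) = s"
    and "\<forall>s\<in>S_set p. G_perm p (G_perm p s) = s" by blast+
qed (use G_perm_in_S_set[OF p] in blast)+

lemma theta_factor_inverse:
  fixes p s t :: int
  assumes p: "prime p" and s: "coprime s p" and s1: "coprime (s + 1) p"
    and t: "coprime t p" and t1: "coprime (t + 1) p" and ts: "[t * s = 1] (mod p)"
  shows "[s * theta_factor p t = theta_factor p s] (mod p)"
proof -
  let ?q = "fermat_quotient p"
  obtain k where k: "t * s = 1 + p * k"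
    using ts by (metis cong_iff_lin cong_sym mult.commute)
  have k': "(t + 1) * s = s + 1 + p * k" using k by (simp add: algebra_simps)
  \<comment> \<open>Here \<open>t * s\<close> is viewed as a shift of 1, whose Fermat quotient is
    0.\<close>
  have "[1 * ?q (1 + p * k) = 1 * ?q 1 - k] (mod p)"
    by (intro fermat_quotient_add_mult p) simp
  moreover have "[?q (t * s) = ?q t + ?q s] (mod p)"
    by (rule fermat_quotient_mult[OF p t s])
  ultimately have "[?q t + ?q s = - k] (mod p)"
    unfolding k by (simp add: fermat_quotient_def) (meson cong_sym cong_trans)
  \<comment> \<open>An explicit multiple of \<open>p\<close> turns the congruence into an equation
    that can be substituted in the final identity.\<close>
  then obtain a where a: "?q t = - k - ?q s + p * a"
    by (metis cong_iff_lin cong_sym diff_add_eq add_diff_cancel_right')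
  have "[(s + 1) * ?q (s + 1 + p * k) = (s + 1) * ?q (s + 1) - k] (mod p)"
    by (intro fermat_quotient_add_mult p s1)
  moreover have "[(s + 1) * ?q ((t + 1) * s) = (s + 1) * (?q (t + 1) + ?q s)] (mod p)"
    by (intro cong_mult cong_refl fermat_quotient_mult p t1 s)
  ultimately have "[(s + 1) * (?q (t + 1) + ?q s) = (s + 1) * ?q (s + 1) - k] (mod p)"
    unfolding k' by (meson cong_sym cong_trans)
  then have b: "p dvd (s + 1) * (?q (t + 1) + ?q s) - ((s + 1) * ?q (s + 1) - k)"
    by (simp add: cong_iff_dvd_diff)
  have "s * theta_factor p t = (t * s) * ?q t - ((t + 1) * s) * ?q (t + 1)"
    by (simp add: theta_factor_def algebra_simps)
  also have "\<dots> = ?q t - (s + 1) * ?q (t + 1) + p * (k * (?q t - ?q (t + 1)))"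
    unfolding k k' by (simp add: algebra_simps)
  finally have st: "s * theta_factor p t =
      ?q t - (s + 1) * ?q (t + 1) + p * (k * (?q t - ?q (t + 1)))" .
  \<comment> \<open>After substituting for \<open>?q t\<close>, the part that is not visibly a
    multiple of \<open>p\<close> is the negative of the expression in \<open>b\<close>.\<close>
  have "s * theta_factor p t - theta_factor p s =
      p * (k * (?q t - ?q (t + 1)) + a) -
      ((s + 1) * (?q (t + 1) + ?q s) - ((s + 1) * ?q (s + 1) - k))"
    unfolding st theta_factor_def[of p s] by (simp add: a algebra_simps)
  then show ?thesis
    using b by (simp add: cong_iff_dvd_diff)
qed

lemma theta_F_perm:
  assumes p: "prime p" and s: "s \<in> S_set p"
  shows "theta p (F_perm p s) = theta p s"
proof -
  have t: "F_perm p s \<in> S_set p" using bij_betw_F_perm s by (rule bij_betw_apply)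
  have "[2 * (F_perm p s * (F_perm p s + 1)) = 2 * (s * (s + 1))] (mod p)"
  proof (rule cong_mult[OF cong_refl])
    \<comment> \<open>Modulo \<open>p\<close>, the reflection exchanges \<open>s\<close> and
      \<open>s + 1\<close> up to sign, so their product is preserved.\<close>
    have "(p - 1 - s) * (p - 1 - s + 1) - s * (s + 1) = p * (p - 1 - 2 * s)"
      by (simp add: algebra_simps)
    then show "[F_perm p s * (F_perm p s + 1) = s * (s + 1)] (mod p)"
      by (simp only: F_perm_eq[OF s] cong_iff_dvd_diff dvd_triv_left)
  qed
  from cong_mult[OF this theta_factor_F_perm[OF p s]]
  show ?thesis
    unfolding theta_eq_Legendre[OF p s] theta_eq_Legendre[OF p t]
    by (intro Legendre_cong_square_mult[of 1]) (simp_all add: mult.assoc)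
qed

lemma theta_G_perm:
  assumes p: "prime p" and s: "s \<in> S_set p"
  shows "theta p (G_perm p s) = theta p s"
proof -
  define t where "t = G_perm p s"
  have t: "t \<in> S_set p" unfolding t_def using p s by (rule G_perm_in_S_set)
  have cop: "coprime x p \<and> coprime (x + 1) p" if "x \<in> S_set p" for x
    using that by (auto simp: S_set_def intro!: coprime_prime_int p)
  have ts: "[t * s = 1] (mod p)"
    unfolding t_def G_perm_def using cop[OF s] by (intro cong_modular_inverse2) simp
  have "[(t + 1) * s = s + 1] (mod p)"
    using cong_add[OF ts cong_refl[of s]] by (simp add: algebra_simps)
  moreover have "[s * theta_factor p t = theta_factor p s] (mod p)"
    using cop[OF s] cop[OF t] by (intro theta_factor_inverse p ts) simp_all
  \<comment> \<open>Of the four factors \<open>s\<close>, three clear \<open>t\<close>,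
    \<open>t + 1\<close> and \<open>theta_factor p t\<close>; the fourth supplies the
    \<open>s\<close> on the right and makes the total multiplier a square.\<close>
  ultimately have "[2 * s * (t * s) * ((t + 1) * s) * (s * theta_factor p t) =
      2 * s * 1 * (s + 1) * theta_factor p s] (mod p)"
    by (intro cong_mult cong_refl ts)
  then have "[2 * s * (s + 1) * theta_factor p s =
      (s\<^sup>2)\<^sup>2 * (2 * t * (t + 1) * theta_factor p t)] (mod p)"
    by (subst cong_sym_eq) (simp add: power2_eq_square mult_ac)
  then show ?thesis
    using cop[OF s] unfolding t_def[symmetric] theta_eq_Legendre[OF p s] theta_eq_Legendre[OF p t]
    by (intro Legendre_cong_square_mult[of "s\<^sup>2", symmetric]) simp_all
qed

theorem theorem6p1:
  fixes p :: int
  assumes "prime p"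
  shows "bij_betw (F_perm p) (S_set p) (S_set p)
       \<and> bij_betw (G_perm p) (S_set p) (S_set p)
       \<and> (\<forall>s\<in>S_set p. theta p (F_perm p s) = theta p s \<and> theta p (G_perm p s) = theta p s)"
  using bij_betw_F_perm bij_betw_G_perm[OF assms] theta_F_perm[OF assms] theta_G_perm[OF assms]
  by blast

end
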